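(* Let $\mathbf{R}$ be the realization matrix and $\mathbf{S}$ the internal stability matrix of the same closed-loop linear system; that is, $\mathbf{R}$ and $\mathbf{S}$ are square transfer matrices of the same size such that, for every external disturbance $\mathbf{d}$, the resulting internal state $\boldsymbol{\eta}$ satisfies both $\boldsymbol{\eta} = \mathbf{R}\boldsymbol{\eta} + \mathbf{d}$ and $\boldsymbol{\eta} = \mathbf{S}\mathbf{d}$. Then $$(I-\mathbf{R})\,\mathbf{S} \;=\; \mathbf{S}\,(I-\mathbf{R}) \;=\; I .$$
   Context: Signals are treated in the frequency domain, as column vectors over the field of rational functions in the transform variable; transfer matrices are matrices over this field (no properness, causality or stability is assumed here), and $I$ is the identity matrix. A closed-loop linear system has an internal state $\boldsymbol{\eta}$, which stacks all signals of the system, and an external disturbance $\mathbf{d}$ of the same dimension as $\boldsymbol{\eta}$, which is arbitrary (every component of $\boldsymbol{\eta}$ has its own component of $\mathbf{d}$). The realization matrix $\mathbf{R}$ is the square transfer matrix describing the operation of the system through $\boldsymbol{\eta} = \mathbf{R}\boldsymbol{\eta} + \mathbf{d}$. The internal stability matrix $\mathbf{S}$ is the transfer matrix from $\mathbf{d}$ to $\boldsymbol{\eta}$, i.e. $\boldsymbol{\eta} = \mathbf{S}\mathbf{d}$ for all $\mathbf{d}$. Existence of both $\mathbf{R}$ and $\mathbf{S}$ is part of the hypothesis. *)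

theory Defs
  imports
    "HOL-Analysis.Determinants"
    "HOL-Computational_Algebra.Polynomial"
    "HOL-Computational_Algebra.Fraction_Field"
begin

text \<open>
  Transfer functions are elements of the field of rational functions in the transform variable,
  i.e. the fraction field of the polynomial ring. The coefficient field \<open>'k\<close> is left arbitrary.
\<close>

type_synonym 'k ratfun = "'k poly fract"

type_synonym ('k, 'n) signal = "('k ratfun, 'n) vec"

type_synonym ('k, 'n) transfer_matrix = "(('k ratfun, 'n) vec, 'n) vec"

text \<open>
  A closed-loop system is given by its response \<open>\<eta>\<close>, which sends each external disturbance \<open>d\<close> to
  the resulting internal state \<open>\<eta> d\<close>. Being a function on all signals, it makes every disturbance
  admissible; no linearity or other property of \<open>\<eta>\<close> is built in.
\<close>

definition realization_matrix ::
  "('k::field, 'n::finite) transfer_matrix \<Rightarrow> (('k, 'n) signal \<Rightarrow> ('k, 'n) signal) \<Rightarrow> bool"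
  where "realization_matrix R \<eta> \<longleftrightarrow> (\<forall>d. \<eta> d = R *v \<eta> d + d)"

definition internal_stability_matrix ::
  "('k::field, 'n::finite) transfer_matrix \<Rightarrow> (('k, 'n) signal \<Rightarrow> ('k, 'n) signal) \<Rightarrow> bool"
  where "internal_stability_matrix S \<eta> \<longleftrightarrow> (\<forall>d. \<eta> d = S *v d)"

end

theory Submission imports Defs begin

text \<open>
  Eliminating the state from \<open>\<eta> d = R *v \<eta> d + d\<close> by \<open>\<eta> d = S *v d\<close> gives
  \<open>(mat 1 - R) *v (S *v d) = d\<close>. The disturbance \<open>d\<close> ranges over all vectors, so this says that
  \<open>S\<close> is a right inverse of \<open>mat 1 - R\<close>. A one-sided inverse of a square matrix over a field is
  two-sided (\<open>matrix_left_right_inverse\<close>), and the rational functions form a field.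
\<close>

theorem lemma1:
  fixes R S :: "('k::field, 'n::finite) transfer_matrix"
    and \<eta> :: "('k, 'n) signal \<Rightarrow> ('k, 'n) signal"
  assumes "realization_matrix R \<eta>"
    and "internal_stability_matrix S \<eta>"
  shows "(mat 1 - R) ** S = mat 1 \<and> S ** (mat 1 - R) = mat 1"
proof -
  have "((mat 1 - R) ** S) *v d = mat 1 *v d" for d
  proof -
    have loop: "S *v d = R *v (S *v d) + d"
      using assms unfolding realization_matrix_def internal_stability_matrix_def by metis
    have "((mat 1 - R) ** S) *v d = S *v d - R *v (S *v d)"
      by (simp add: matrix_vector_mult_diff_rdistrib flip: matrix_vector_mul_assoc)
    also have "\<dots> = d"
      using loop by (metis add_diff_cancel_left')
    finally show ?thesis
      by simp
  qed
  then have right_inverse: "(mat 1 - R) ** S = mat 1"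
    by (simp add: matrix_eq)
  then show ?thesis
    using matrix_left_right_inverse by blast
qed

end
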